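(* There is a connected complete metric space $Z$ with cardinality and density both equal to $\mathfrak c$ and a monotone continuous hereditarily quotient surjection $f\colon Z\to(0,1)$ that has a local extremum at every point, i.e. each point $z\in Z$ is a point of local maximum or local minimum of $f$.
   Context: $\mathfrak c$ is the cardinality of the continuum; the density of a space is the least cardinality of a dense subset. For topological spaces $X,Y$, a function $f\colon X\to Y$ is: monotone if $f^{-1}(y)$ is connected for each $y\in Y$; hereditarily quotient if for every open $U\subset X$ and every $y\in Y$, $f^{-1}(y)\subset U$ implies $y\in\mathrm{Int}(f(U))$. Local maximum and local minimum are understood in the non-strict sense. The interval $(0,1)$ carries its usual topology. *)

theory Defs
  imports "HOL-Analysis.Analysis"
begin

(* The density of X is the least cardinality of a dense subset; has_density X K says that
   this least cardinality is attained and equals that of the set K, which only serves as a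
   representative of a cardinal and may have another element type. *)
definition has_density :: "'a topology \<Rightarrow> 'b set \<Rightarrow> bool" where
  "has_density X K \<longleftrightarrow>
     (\<exists>D. D \<subseteq> topspace X \<and> X closure_of D = topspace X \<and> D \<approx> K) \<and>
     (\<forall>D. D \<subseteq> topspace X \<and> X closure_of D = topspace X \<longrightarrow> K \<lesssim> D)"

definition hereditarily_quotient_map :: "'a topology \<Rightarrow> 'b topology \<Rightarrow> ('a \<Rightarrow> 'b) \<Rightarrow> bool" where
  "hereditarily_quotient_map X Y f \<longleftrightarrow>
     f ` topspace X \<subseteq> topspace Y \<and>
     (\<forall>U y. openin X U \<and> y \<in> topspace Y \<and> {x \<in> topspace X. f x = y} \<subseteq> U
        \<longrightarrow> y \<in> Y interior_of (f ` U))"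

definition local_max_at :: "'a topology \<Rightarrow> ('a \<Rightarrow> 'b::linorder) \<Rightarrow> 'a \<Rightarrow> bool" where
  "local_max_at X f z \<longleftrightarrow> (\<exists>U. openin X U \<and> z \<in> U \<and> (\<forall>w\<in>U. f w \<le> f z))"

definition local_min_at :: "'a topology \<Rightarrow> ('a \<Rightarrow> 'b::linorder) \<Rightarrow> 'a \<Rightarrow> bool" where
  "local_min_at X f z \<longleftrightarrow> (\<exists>U. openin X U \<and> z \<in> U \<and> (\<forall>w\<in>U. f z \<le> f w))"

end

theory Submission
  imports Defs
begin

text \<open>
  The space is a metric graph with small pieces cut out. Every level \<open>t\<close> of \<open>(0,1)\<close> has a centre
  \<open>c\<^sub>t\<close>, and every \<open>s\<close> in \<open>(0,1)\<close> has two hubs, an upper one \<open>(s, True)\<close> and a lower one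
  \<open>(s, False)\<close>. An edge of length 1 joins \<open>c\<^sub>t\<close> to the upper hubs of all \<open>s \<le> t\<close> and to the lower
  hubs of all \<open>s \<ge> t\<close>. From the edge between \<open>c\<^sub>t\<close> and a hub of \<open>s\<close>, the points at distance less than
  \<open>\<bar>t - s\<bar>\<close> from the hub are removed; what remains is a spine of the fibre over \<open>t\<close>, and \<open>f\<close> maps it
  to \<open>t\<close>. A hub of \<open>s\<close> itself thus survives only as the end of the spine at level \<open>s\<close>.

  The fibre over \<open>t\<close> is a hedgehog of intervals sharing \<open>c\<^sub>t\<close>, so it is connected. A point at distance
  \<open>u > 0\<close> from its hub is at distance at least \<open>u\<close> from every other fibre, so \<open>f\<close> is constant near it. Near
  an upper hub of \<open>s\<close> there are only spines leading to that hub, and all of them lie at levels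
  \<open>\<ge> s\<close>: the hub is a local minimum. Likewise a lower hub is a local maximum. Conversely, the spine
  at level \<open>t\<close> reaches up to distance \<open>\<bar>t - s\<bar>\<close> to the hub, so a neighbourhood of the two hubs in the
  fibre over \<open>s\<close> meets all fibres over a neighbourhood of \<open>s\<close>. Hence \<open>f\<close> is hereditarily
  quotient; as a monotone quotient map onto an interval it forces the space to be connected.

  For the metric, a point on the spine between \<open>c\<^sub>t\<close> and the hub \<open>h\<close>, at distance \<open>u\<close> from \<open>h\<close>, is
  represented by two points of hedgehogs with infinitely many spines: one at radius \<open>u\<close> on the spine
  indexed by \<open>t\<close>, the other at radius \<open>1 - u\<close> on the spine indexed by \<open>h\<close>. The distance of two points is
  the sum of the two hedgehog distances. This makes the triangle inequality immediate, and locally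
  it is comparable to the length of a path in the graph. A Cauchy sequence has convergent \<open>u\<close>;
  if the limit is positive the level is eventually constant, if it is less than 1 the hub is, and
  the limit point can be written down in each case.

  The ball of radius 1 about a centre lies in its fibre, so a dense set meets every fibre, which gives
  the density. Since the set of coordinates \<open>(t, h, u)\<close> has the cardinality of the continuum, the points
  can be coded by reals.
\<close>

section \<open>Hereditarily quotient maps\<close>

lemma hereditarily_quotient_map_imp_quotient_map:
  assumes hq: "hereditarily_quotient_map X Y f"
    and f: "continuous_map X Y f" "f ` topspace X = topspace Y"
  shows "quotient_map X Y f"
  unfolding quotient_map_def
proof (intro conjI allI impI)
  show "f ` topspace X = topspace Y" by fact
  fix V assume V: "V \<subseteq> topspace Y"
  let ?P = "{x \<in> topspace X. f x \<in> V}"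
  show "openin X ?P \<longleftrightarrow> openin Y V"
  proof
    assume P: "openin X ?P"
    have "y \<in> Y interior_of V" if "y \<in> V" for y
    proof -
      have "y \<in> Y interior_of (f ` ?P)"
        using hq P that V unfolding hereditarily_quotient_map_def by blast
      moreover have "f ` ?P \<subseteq> V" by auto
      ultimately show ?thesis using interior_of_mono by blast
    qed
    then have "Y interior_of V = V" using interior_of_subset[of Y V] by blast
    then show "openin Y V" by (simp add: interior_of_eq)
  qed (use f in \<open>simp add: continuous_map_def\<close>)
qed

section \<open>The railway metric\<close>

text \<open>
  The distance on a family of lines glued together at 0: between different lines one has to travel
  through 0. Absolute values are taken also in the second case, which makes it a pseudometric
  on all pairs.
\<close>
definition rail :: "'b \<Rightarrow> real \<Rightarrow> 'b \<Rightarrow> real \<Rightarrow> real" where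
  "rail x a y b = (if x = y then \<bar>a - b\<bar> else \<bar>a\<bar> + \<bar>b\<bar>)"

lemma rail_triangle: "rail x a z c \<le> rail x a y b + rail y b z c"
  by (auto simp: rail_def)

lemma rail_commute: "rail x a y b = rail y b x a"
  by (auto simp: rail_def)

lemma rail_nonneg: "0 \<le> rail x a y b"
  by (auto simp: rail_def)

lemma rail_eq_0: "rail x a y b = 0 \<longleftrightarrow> a = b \<and> (x = y \<or> a = 0)"
  by (auto simp: rail_def)

lemma rail_ge_diff: "\<bar>a - b\<bar> \<le> rail x a y b"
  by (auto simp: rail_def)

section \<open>The truncated graph\<close>

text \<open>
  A hub is a pair \<open>(s, b)\<close>, and \<open>side\<close> consists of the levels with an edge to it. The level \<open>s\<close>
  itself belongs to both sides.
\<close>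
definition side :: "real \<times> bool \<Rightarrow> real set" where
  "side h = (if snd h then {fst h..} else {..fst h})"

text \<open>
  All spines at level \<open>t\<close> share their end \<open>u = 1\<close>, the centre. The last condition selects one of its
  many descriptions, so that points correspond bijectively to coordinates.
\<close>
definition graph_coords :: "(real \<times> (real \<times> bool) \<times> real) set" where
  "graph_coords = {(t, h, u). t \<in> {0<..<1} \<and> fst h \<in> {0<..<1} \<and> t \<in> side h \<and>
     \<bar>t - fst h\<bar> \<le> u \<and> u \<le> 1 \<and> (u = 1 \<longrightarrow> h = (t, True))}"

text \<open>
  The points may have any type, as long as they are in bijection with the coordinates; in the end
  they are real numbers.
\<close>
locale hub_graph =
  fixes C :: "'a set" and coord :: "'a \<Rightarrow> real \<times> (real \<times> bool) \<times> real"
  assumes bij_coord: "bij_betw coord C graph_coords"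
begin

definition lev :: "'a \<Rightarrow> real" where "lev p = fst (coord p)"
definition hub :: "'a \<Rightarrow> real \<times> bool" where "hub p = fst (snd (coord p))"
definition dep :: "'a \<Rightarrow> real" where "dep p = snd (snd (coord p))"

text \<open>
  For fixed \<open>t\<close> and \<open>h\<close> the map \<open>pt t h\<close> runs through a whole spine, up to and including the centre;
  the case distinction passes to the description of the centre selected above.
\<close>
definition pt :: "real \<Rightarrow> real \<times> bool \<Rightarrow> real \<Rightarrow> 'a" where
  "pt t h u = inv_into C coord (t, if u = 1 then (t, True) else h, u)"

definition dst :: "'a \<Rightarrow> 'a \<Rightarrow> real" where
  "dst p q = rail (lev p) (dep p) (lev q) (dep q) + rail (hub p) (1 - dep p) (hub q) (1 - dep q)"

lemma in_C:
  assumes "p \<in> C"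
  shows "0 < lev p" "lev p < 1" "0 < fst (hub p)" "fst (hub p) < 1" "lev p \<in> side (hub p)"
    "\<bar>lev p - fst (hub p)\<bar> \<le> dep p" "dep p \<le> 1" "dep p = 1 \<Longrightarrow> hub p = (lev p, True)" "0 \<le> dep p"
proof -
  have "coord p \<in> graph_coords"
    using bij_coord assms by (auto simp: bij_betw_def)
  then show "0 < lev p" "lev p < 1" "0 < fst (hub p)" "fst (hub p) < 1" "lev p \<in> side (hub p)"
    "\<bar>lev p - fst (hub p)\<bar> \<le> dep p" "dep p \<le> 1" "dep p = 1 \<Longrightarrow> hub p = (lev p, True)" "0 \<le> dep p"
    by (auto simp: graph_coords_def lev_def hub_def dep_def case_prod_beta)
qed

lemma point_eqI:
  assumes "p \<in> C" "q \<in> C" "lev p = lev q" "hub p = hub q" "dep p = dep q"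
  shows "p = q"
proof -
  have "coord p = coord q" using assms by (simp add: lev_def hub_def dep_def prod_eq_iff)
  then show ?thesis using assms bij_coord by (auto simp: bij_betw_def inj_on_def)
qed

lemma pt:
  assumes "0 < t" "t < 1" "0 < fst h" "fst h < 1" "t \<in> side h" "\<bar>t - fst h\<bar> \<le> u" "u \<le> 1"
  shows "pt t h u \<in> C" "lev (pt t h u) = t" "dep (pt t h u) = u"
    "hub (pt t h u) = (if u = 1 then (t, True) else h)"
proof -
  have "(t, if u = 1 then (t, True) else h, u) \<in> graph_coords"
    using assms by (auto simp: graph_coords_def side_def)
  then have *: "(t, if u = 1 then (t, True) else h, u) \<in> coord ` C"
    using bij_coord by (auto simp: bij_betw_def)
  then show "pt t h u \<in> C" unfolding pt_def by (rule inv_into_into)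
  from * have "coord (pt t h u) = (t, if u = 1 then (t, True) else h, u)"
    unfolding pt_def by (rule f_inv_into_f)
  then show "lev (pt t h u) = t" "dep (pt t h u) = u"
    "hub (pt t h u) = (if u = 1 then (t, True) else h)"
    by (simp_all add: lev_def dep_def hub_def)
qed

lemma pt_own: "p \<in> C \<Longrightarrow> pt (lev p) (hub p) (dep p) = p"
  by (rule point_eqI) (use in_C[of p] pt[of "lev p" "hub p" "dep p"] in auto)

section \<open>The metric and its local structure\<close>

text \<open>
  Separation at \<open>u = 0\<close> needs the truncation: the two hub radii are then 1, so the hubs agree, and
  at depth 0 the level is determined by the hub.
\<close>
lemma dst_eq_0:
  assumes "p \<in> C" "q \<in> C"
  shows "dst p q = 0 \<longleftrightarrow> p = q"
proof
  assume "dst p q = 0"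
  then have 1: "rail (lev p) (dep p) (lev q) (dep q) = 0"
    and 2: "rail (hub p) (1 - dep p) (hub q) (1 - dep q) = 0"
    unfolding dst_def
    using rail_nonneg[of "lev p" "dep p" "lev q" "dep q"]
      rail_nonneg[of "hub p" "1 - dep p" "hub q" "1 - dep q"] by linarith+
  from 1 have dep: "dep p = dep q" by (simp add: rail_eq_0)
  consider "lev p = lev q" | "dep p = 0" using 1 by (auto simp: rail_eq_0)
  then show "p = q"
  proof cases
    case 1
    then have "hub p = hub q" using 2 dep in_C(8)[of p] in_C(8)[of q] assms by (auto simp: rail_eq_0)
    with 1 dep show ?thesis using assms by (intro point_eqI) auto
  next
    case 2
    then have "hub p = hub q" using \<open>rail (hub p) _ _ _ = 0\<close> by (auto simp: rail_eq_0)
    moreover have "lev p = lev q"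
      using in_C(6)[of p] in_C(6)[of q] assms dep 2 calculation by simp
    ultimately show ?thesis using assms dep by (intro point_eqI) auto
  qed
qed (simp add: dst_def rail_def)

sublocale Metric_space C dst
proof
  show "0 \<le> dst p q" for p q by (simp add: dst_def rail_nonneg)
  show "dst p q = dst q p" for p q by (simp add: dst_def rail_commute)
  show "dst p r \<le> dst p q + dst q r" for p q r
    unfolding dst_def by (smt (verit) rail_triangle)
qed (rule dst_eq_0)

lemma dst_ge_dep_diff: "\<bar>dep p - dep q\<bar> \<le> dst p q"
  unfolding dst_def
  using rail_ge_diff[of "dep p" "dep q" "lev p" "lev q"]
    rail_nonneg[of "hub p" "1 - dep p" "hub q" "1 - dep q"] by linarith

text \<open>
  The next two estimates control the local structure: the fibre can only be left by moving towards
  a hub, and the hub can only be changed by moving towards a centre.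
\<close>
lemma dst_ge_dep:
  assumes "p \<in> C" "q \<in> C" "lev p \<noteq> lev q"
  shows "dep p \<le> dst p q"
  unfolding dst_def
  using assms in_C(9)[of q] rail_nonneg[of "hub p" "1 - dep p" "hub q" "1 - dep q"]
  by (simp add: rail_def[of "lev p"])

lemma dst_ge_codep:
  assumes "p \<in> C" "q \<in> C" "hub p \<noteq> hub q"
  shows "1 - dep p \<le> dst p q"
  unfolding dst_def
  using assms in_C(7)[of q] rail_nonneg[of "lev p" "dep p" "lev q" "dep q"]
  by (simp add: rail_def[of "hub p"])

text \<open>
  On spines of a common hub \<open>h\<close> the truncation bounds each depth below by the distance of the level
  from \<open>fst h\<close>. If both level and hub differ, the distance is 2, more than the length of \<open>(0,1)\<close>.
\<close>
lemma lev_lipschitz: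
  assumes "p \<in> C" "q \<in> C"
  shows "\<bar>lev p - lev q\<bar> \<le> dst p q"
proof (cases "lev p = lev q")
  case False
  show ?thesis
  proof (cases "hub p = hub q")
    case True
    have "\<bar>lev p - lev q\<bar> \<le> dep p + dep q"
      using in_C(6)[OF assms(1)] in_C(6)[OF assms(2)] unfolding True by linarith
    also have "\<dots> \<le> dst p q"
      using False in_C(9) assms True by (simp add: dst_def rail_def)
    finally show ?thesis .
  next
    case h: False
    have "dst p q = 2" using False h assms in_C(7,9) by (simp add: dst_def rail_def)
    then show ?thesis using in_C(1,2)[OF assms(1)] in_C(1,2)[OF assms(2)] by linarith
  qed
qed simp

text \<open>
  Away from the hubs the level is locally constant. The unit ball about a hub contains only points
  belonging to that hub, hence only levels on one side.
\<close>
lemma local_extremum: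
  assumes p: "p \<in> C"
  shows "local_max_at mtopology lev p \<or> local_min_at mtopology lev p"
proof (cases "dep p = 0")
  case False
  then have pos: "dep p > 0" using in_C(9)[OF p] by simp
  have "lev w = lev p" if "w \<in> mball p (dep p)" for w
    using that dst_ge_dep[of p w] by force
  then show ?thesis
    unfolding local_max_at_def using pos p by (metis centre_in_mball_iff openin_mball order_refl)
next
  case True
  then have lev: "lev p = fst (hub p)" using in_C(6)[OF p] by simp
  have "lev w \<in> side (hub p)" if "w \<in> mball p 1" for w
    using that dst_ge_codep[of p w] True in_C(5)[of w] by force
  then have "(\<forall>w\<in>mball p 1. lev w \<le> lev p) \<or> (\<forall>w\<in>mball p 1. lev p \<le> lev w)"
    unfolding lev side_def by (cases "snd (hub p)") auto
  then show ?thesis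
    unfolding local_max_at_def local_min_at_def
    using p by (metis centre_in_mball_iff openin_mball zero_less_one)
qed

section \<open>Completeness\<close>

text \<open>
  The depths converge, say to \<open>u\<close>. The limit of the sequence is a hub if \<open>u = 0\<close>, a centre if
  \<open>u = 1\<close>, and otherwise lies on the one spine that eventually carries the sequence; in the last case
  the truncation bound passes to the limit. In particular a sequence whose levels are not
  eventually constant converges to a hub, so levels never escape to an end of \<open>(0,1)\<close>.
\<close>
lemma mcomplete: "mcomplete"
  unfolding mcomplete_def
proof (intro allI impI)
  fix \<sigma> assume cau: "MCauchy \<sigma>"
  then have in_C': "\<sigma> n \<in> C" for n by (auto simp: MCauchy_def)
  have cauE: "\<exists>N. \<forall>m\<ge>N. \<forall>n\<ge>N. dst (\<sigma> m) (\<sigma> n) < e" if "e > 0" for e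
    using cau that unfolding MCauchy_def by meson
  have "Cauchy (\<lambda>n. dep (\<sigma> n))"
    unfolding Cauchy_def dist_real_def
    using cauE dst_ge_dep_diff by (meson le_less_trans)
  then obtain u where u: "(\<lambda>n. dep (\<sigma> n)) \<longlonglongrightarrow> u"
    using Cauchy_convergent_iff convergent_def by blast
  have u01: "0 \<le> u" "u \<le> 1"
    using in_C(7,9)[OF in_C'] LIMSEQ_le_const[OF u] LIMSEQ_le_const2[OF u] by blast+
  have lev_const: "\<exists>N t. \<forall>n\<ge>N. lev (\<sigma> n) = t" if "0 < u"
  proof -
    have "eventually (\<lambda>n. u / 2 < dep (\<sigma> n)) sequentially"
      by (rule order_tendstoD(1)[OF u]) (use that in simp)
    then obtain N1 where N1: "\<And>n. n \<ge> N1 \<Longrightarrow> u / 2 < dep (\<sigma> n)"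
      unfolding eventually_sequentially by blast
    obtain N2 where N2: "\<And>m n. m \<ge> N2 \<Longrightarrow> n \<ge> N2 \<Longrightarrow> dst (\<sigma> m) (\<sigma> n) < u / 2"
      using cauE[of "u/2"] half_gt_zero[OF \<open>0 < u\<close>] by meson
    have "lev (\<sigma> n) = lev (\<sigma> (max N1 N2))" if "n \<ge> max N1 N2" for n
      using dst_ge_dep[OF in_C' in_C', of n "max N1 N2"] N1[of n] N2[of n "max N1 N2"] that by force
    then show ?thesis by blast
  qed
  have hub_const: "\<exists>N h. \<forall>n\<ge>N. hub (\<sigma> n) = h" if "u < 1"
  proof -
    have "eventually (\<lambda>n. dep (\<sigma> n) < (1 + u) / 2) sequentially"
      by (rule order_tendstoD(2)[OF u]) (use that in simp)
    then obtain N1 where N1: "\<And>n. n \<ge> N1 \<Longrightarrow> dep (\<sigma> n) < (1 + u) / 2"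
      unfolding eventually_sequentially by blast
    obtain N2 where N2: "\<And>m n. m \<ge> N2 \<Longrightarrow> n \<ge> N2 \<Longrightarrow> dst (\<sigma> m) (\<sigma> n) < (1 - u) / 2"
      using cauE[of "(1-u)/2"] \<open>u < 1\<close> by (meson diff_gt_0_iff_gt half_gt_zero)
    have "hub (\<sigma> n) = hub (\<sigma> (max N1 N2))" if "n \<ge> max N1 N2" for n
      using dst_ge_codep[OF in_C' in_C', of n "max N1 N2"] N1[of n] N2[of n "max N1 N2"] that
      by (force simp: field_simps)
    then show ?thesis by blast
  qed
  \<comment> \<open>In each case below \<open>p\<close> has depth \<open>u\<close>, and the tail of the sequence lies on spines ending at \<open>p\<close> or
    containing \<open>p\<close>, so the distance to \<open>p\<close> is twice the difference in depth.\<close>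
  have *: "\<exists>p. limitin mtopology \<sigma> p sequentially"
    if "p \<in> C" "\<exists>N. \<forall>n\<ge>N. dst (\<sigma> n) p \<le> 2 * \<bar>dep (\<sigma> n) - u\<bar>" for p
  proof -
    have "(\<lambda>n. 2 * \<bar>dep (\<sigma> n) - u\<bar>) \<longlonglongrightarrow> 0"
      using u by (intro tendsto_mult_right_zero tendsto_rabs_zero) (simp add: LIM_zero)
    then have "(\<lambda>n. dst (\<sigma> n) p) \<longlonglongrightarrow> 0"
      by (rule Lim_null_comparison[rotated]) (use that in \<open>auto simp: eventually_sequentially\<close>)
    then show ?thesis
      using that in_C' by (auto simp: limitin_metric_dist_null)
  qed
  consider "u = 0" | "0 < u" "u < 1" | "u = 1" using u01 by linarith
  then show "\<exists>p. limitin mtopology \<sigma> p sequentially"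
  proof cases
    case 1
    then obtain N h where N: "\<And>n. n \<ge> N \<Longrightarrow> hub (\<sigma> n) = h" using hub_const by auto
    have h: "0 < fst h" "fst h < 1" using in_C(3,4)[OF in_C'[of N]] N by auto
    have P: "pt (fst h) h 0 \<in> C" "lev (pt (fst h) h 0) = fst h" "dep (pt (fst h) h 0) = 0"
      "hub (pt (fst h) h 0) = h"
      using pt[of "fst h" h 0] h by (auto simp: side_def)
    have "dst (\<sigma> n) (pt (fst h) h 0) \<le> 2 * \<bar>dep (\<sigma> n) - u\<bar>" if "n \<ge> N" for n
      using N[OF that] P 1 by (simp add: dst_def rail_def)
    with P(1) show ?thesis by (intro *) blast+
  next
    case 2
    obtain N1 h where N1: "\<And>n. n \<ge> N1 \<Longrightarrow> hub (\<sigma> n) = h" using hub_const[OF 2(2)] by auto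
    obtain N2 t where N2: "\<And>n. n \<ge> N2 \<Longrightarrow> lev (\<sigma> n) = t" using lev_const[OF 2(1)] by auto
    define N where "N = max N1 N2"
    have N: "hub (\<sigma> n) = h" "lev (\<sigma> n) = t" if "n \<ge> N" for n
      using N1[of n] N2[of n] that by (auto simp: N_def)
    have "\<bar>t - fst h\<bar> \<le> dep (\<sigma> n)" if "n \<ge> N" for n
      using in_C(6)[OF in_C'[of n]] N[OF that] by simp
    then have "\<bar>t - fst h\<bar> \<le> u" using LIMSEQ_le_const[OF u] by blast
    then have P: "pt t h u \<in> C" "lev (pt t h u) = t" "dep (pt t h u) = u" "hub (pt t h u) = h"
      using pt[of t h u] in_C(1-5)[OF in_C'[of N]] N[of N] 2 by auto
    have "dst (\<sigma> n) (pt t h u) \<le> 2 * \<bar>dep (\<sigma> n) - u\<bar>" if "n \<ge> N" for n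
      using N[OF that] P by (simp add: dst_def rail_def)
    with P(1) show ?thesis by (intro *) blast+
  next
    case 3
    then obtain N t where N: "\<And>n. n \<ge> N \<Longrightarrow> lev (\<sigma> n) = t" using lev_const by auto
    have P: "pt t (t, True) 1 \<in> C" "lev (pt t (t, True) 1) = t" "dep (pt t (t, True) 1) = 1"
      using pt[of t "(t, True)" 1] in_C(1,2)[OF in_C'[of N]] N[of N] by (auto simp: side_def)
    have "dst (\<sigma> n) (pt t (t, True) 1) \<le> 2 * \<bar>dep (\<sigma> n) - u\<bar>" if "n \<ge> N" for n
      using N[OF that] P 3 in_C(7)[OF in_C'[of n]] by (simp add: dst_def rail_def)
    with P(1) show ?thesis by (intro *) blast+
  qed
qed

section \<open>Fibres of the level map\<close>

lemma mtopology_of_Self: "mtopology_of Self = mtopology"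
  by (simp add: mtopology_of_def Self_def)

lemma lev_image: "lev ` C = {0<..<1}"
proof
  show "lev ` C \<subseteq> {0<..<1}" using in_C(1,2) by auto
  show "{0<..<1} \<subseteq> lev ` C"
  proof
    fix t :: real assume "t \<in> {0<..<1}"
    then have "pt t (t, True) 1 \<in> C" "lev (pt t (t, True) 1) = t"
      using pt[of t "(t, True)" 1] by (auto simp: side_def)
    then show "t \<in> lev ` C" by (metis imageI)
  qed
qed

lemma continuous_lev: "continuous_map mtopology (top_of_set {0<..<1}) lev"
proof -
  have "Lipschitz_continuous_map Self euclidean_metric lev"
    unfolding Lipschitz_continuous_map_def
    using lev_lipschitz by (auto simp: dist_real_def intro!: exI[of _ 1])
  then have "continuous_map mtopology euclidean lev"
    using Lipschitz_continuous_imp_continuous_map[of Self euclidean_metric]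
    by (simp add: mtopology_of_Self)
  then show ?thesis
    using lev_image by (auto simp: continuous_map_in_subtopology)
qed

text \<open>The part of a spine between \<open>p\<close> and the centre is a Lipschitz image of an interval.\<close>
lemma spine_connected:
  assumes p: "p \<in> C"
  shows "connectedin mtopology (pt (lev p) (hub p) ` {dep p..1})"
proof -
  let ?I = "submetric euclidean_metric {dep p..1}"
  have P: "pt (lev p) (hub p) u \<in> C \<and> lev (pt (lev p) (hub p) u) = lev p \<and> dep (pt (lev p) (hub p) u) = u
     \<and> hub (pt (lev p) (hub p) u) = (if u = 1 then (lev p, True) else hub p)"
    if "u \<in> {dep p..1}" for u
    using pt[of "lev p" "hub p" u] in_C[OF p] that by auto
  have "Lipschitz_continuous_map ?I Self (pt (lev p) (hub p))"
    unfolding Lipschitz_continuous_map_def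
  proof (intro conjI exI[of _ 2] ballI)
    fix u v assume "u \<in> mspace ?I" "v \<in> mspace ?I"
    then show "mdist Self (pt (lev p) (hub p) u) (pt (lev p) (hub p) v) \<le> 2 * mdist ?I u v"
      using P[of u] P[of v] by (auto simp: dst_def rail_def dist_real_def)
  qed (use P in auto)
  then have "continuous_map (top_of_set {dep p..1}) mtopology (pt (lev p) (hub p))"
    using Lipschitz_continuous_imp_continuous_map[of ?I Self]
    by (simp add: mtopology_of_submetric mtopology_of_Self)
  then show ?thesis
    by (rule connectedin_continuous_map_image) (simp add: connectedin_subtopology)
qed

lemma monotone_lev: "monotone_map mtopology (top_of_set {0<..<1}) lev"
  unfolding monotone_map_def
proof (intro conjI ballI)
  show "lev ` topspace mtopology \<subseteq> topspace (top_of_set {0<..<1})" using lev_image by simp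
  fix t :: real assume "t \<in> topspace (top_of_set {0<..<1})"
  then have t: "0 < t" "t < 1" by auto
  let ?F = "{p \<in> topspace mtopology. lev p = t}"
  let ?S = "\<lambda>p. pt (lev p) (hub p) ` {dep p..1}"
  have c: "pt t h 1 = pt t (t, True) 1" for h by (simp add: pt_def)
  have center: "pt t (t, True) 1 \<in> ?F"
    using pt[of t "(t, True)" 1] t by (auto simp: side_def)
  have "?F = \<Union> (?S ` ?F)"
  proof
    show "?F \<subseteq> \<Union> (?S ` ?F)"
    proof
      fix p assume p: "p \<in> ?F"
      then have "p = pt (lev p) (hub p) (dep p)" using pt_own[of p] by simp
      moreover have "dep p \<in> {dep p..1}" using p in_C(7)[of p] by simp
      ultimately show "p \<in> \<Union> (?S ` ?F)" using p by blast
    qed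
    have "pt (lev p) (hub p) u \<in> ?F" if "p \<in> ?F" "u \<in> {dep p..1}" for p u
      using pt[of "lev p" "hub p" u] in_C[of p] that by auto
    then show "\<Union> (?S ` ?F) \<subseteq> ?F" by blast
  qed
  moreover have "connectedin mtopology (\<Union> (?S ` ?F))"
  proof (rule connectedin_Union)
    show "connectedin mtopology S" if "S \<in> ?S ` ?F" for S
      using that spine_connected by auto
    have "pt t (t, True) 1 \<in> ?S p" if p: "p \<in> ?F" for p
    proof -
      have "pt (lev p) (hub p) 1 = pt t (t, True) 1" using p c by simp
      moreover have "1 \<in> {dep p..1}" using p in_C(7)[of p] by simp
      ultimately show ?thesis by (metis imageI)
    qed
    then show "\<Inter> (?S ` ?F) \<noteq> {}" by blast
  qed
  ultimately show "connectedin mtopology ?F" by metis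
qed

text \<open>
  An open neighbourhood of the fibre over \<open>t\<close> contains balls about the upper and the lower hub of
  \<open>t\<close>. For a level \<open>s\<close> close to \<open>t\<close>, the truncated end of the spine between the centre of \<open>s\<close> and
  the hub of \<open>t\<close> on the side of \<open>s\<close> lies in one of these balls.
\<close>
lemma hereditarily_quotient_lev: "hereditarily_quotient_map mtopology (top_of_set {0<..<1}) lev"
  unfolding hereditarily_quotient_map_def
proof (intro conjI allI impI)
  show "lev ` topspace mtopology \<subseteq> topspace (top_of_set {0<..<1})" using lev_image by simp
  fix U and t :: real
  assume "openin mtopology U \<and> t \<in> topspace (top_of_set {0<..<1}) \<and>
    {x \<in> topspace mtopology. lev x = t} \<subseteq> U"
  then have U: "openin mtopology U" and t: "0 < t" "t < 1"
    and sub: "{x \<in> topspace mtopology. lev x = t} \<subseteq> U" by auto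
  have "\<exists>r>0. mball (pt t (t, b) 0) r \<subseteq> U" for b
  proof -
    have "pt t (t, b) 0 \<in> U" using sub pt[of t "(t, b)" 0] t by (auto simp: side_def)
    then show ?thesis using U by (simp add: openin_mtopology)
  qed
  then obtain r where r: "\<And>b. r b > 0" "\<And>b. mball (pt t (t, b) 0) (r b) \<subseteq> U" by metis
  \<comment> \<open>The end of the spine at level \<open>s\<close> has distance \<open>2 * \<bar>s - t\<bar>\<close> from the hub, hence the factor.\<close>
  define e where "e = min (r True) (r False) / 2"
  have e: "e > 0" using r(1) by (simp add: e_def)
  let ?T = "{0<..<1} \<inter> ball t e"
  have "s \<in> lev ` U" if s: "s \<in> ?T" for s
  proof -
    define b where "b = (t \<le> s)"
    have le: "\<bar>s - t\<bar> < e" "\<bar>s - t\<bar> < 1" using s t by (auto simp: dist_real_def)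
    then have *: "2 * \<bar>s - t\<bar> < r b" by (cases b) (simp_all add: e_def)
    let ?q = "pt s (t, b) \<bar>s - t\<bar>"
    have q: "?q \<in> C" "lev ?q = s" "dep ?q = \<bar>s - t\<bar>" "hub ?q = (t, b)"
      using pt[of s "(t, b)" "\<bar>s - t\<bar>"] s t le by (auto simp: side_def b_def)
    have p: "pt t (t, b) 0 \<in> C" "lev (pt t (t, b) 0) = t" "dep (pt t (t, b) 0) = 0"
      "hub (pt t (t, b) 0) = (t, b)"
      using pt[of t "(t, b)" 0] t by (auto simp: side_def)
    have "dst (pt t (t, b) 0) ?q = 2 * \<bar>s - t\<bar>" using p q le by (auto simp: dst_def rail_def)
    then have "?q \<in> U" using r(2)[of b] p q * by auto
    then show ?thesis using q by (metis imageI)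
  qed
  then have "?T \<subseteq> lev ` U" by blast
  moreover have "openin (top_of_set {0<..<1}) ?T" by (simp add: openin_open_Int)
  ultimately show "t \<in> top_of_set {0<..<1} interior_of (lev ` U)"
    unfolding interior_of_def using t e by (auto intro!: exI[of _ ?T])
qed

lemma connected_mtopology: "connected_space mtopology"
proof (rule connected_space_monotone_quotient_map_preimage)
  show "monotone_map mtopology (top_of_set {0<..<1}) lev" by (rule monotone_lev)
  show "quotient_map mtopology (top_of_set {0<..<1}) lev"
    using hereditarily_quotient_lev continuous_lev lev_image
    by (intro hereditarily_quotient_map_imp_quotient_map) auto
  show "connected_space (top_of_set {0<..<1::real})"
    using connectedin_def[of euclidean "{0<..<1::real}"] by simp
qed

section \<open>Cardinality and density\<close>

text \<open>A dense set meets every fibre, because the unit ball about a centre stays in its fibre.\<close>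
lemma reals_lepoll_dense:
  assumes D: "D \<subseteq> C" "mtopology closure_of D = C"
  shows "(UNIV :: real set) \<lesssim> D"
proof -
  have "\<exists>p\<in>D. lev p = t" if "t \<in> {0<..<1}" for t
  proof -
    let ?c = "pt t (t, True) 1"
    have c: "?c \<in> C" "lev ?c = t" "dep ?c = 1"
      using pt[of t "(t, True)" 1] that by (auto simp: side_def)
    then have "mball ?c 1 \<inter> D \<noteq> {}"
      using D(2) by (metis Int_commute centre_in_mball_iff dense_intersects_open empty_iff
          openin_mball topspace_mtopology zero_less_one)
    then obtain p where "p \<in> D" "p \<in> mball ?c 1" by blast
    then show ?thesis using dst_ge_dep[of ?c p] c by force
  qed
  then have "{0<..<1} \<subseteq> lev ` D" by force
  then have "{0<..<1::real} \<lesssim> D" by (rule subset_image_lepoll)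
  moreover have "(UNIV :: real set) \<approx> {0<..<1::real}"
    by (simp add: open_interval_eqpoll_reals eqpoll_sym)
  ultimately show ?thesis using lepoll_trans1 by blast
qed

end

lemma graph_coords_lepoll_reals: "graph_coords \<lesssim> (UNIV :: real set)"
proof -
  have sq: "(UNIV :: (real \<times> real) set) \<approx> (UNIV :: real set)"
    using card_of_Times_same_infinite[of "UNIV :: real set"] infinite_UNIV_char_0
    by (simp add: eqpoll_iff_card_of_ordIso)
  have prod: "(UNIV :: ('b \<times> 'c) set) \<lesssim> (UNIV :: real set)"
    if "(UNIV :: 'b set) \<lesssim> (UNIV :: real set)" "(UNIV :: 'c set) \<lesssim> (UNIV :: real set)"
    using lepoll_trans2[OF times_lepoll_mono[OF that]] sq by simp
  have "(UNIV :: bool set) \<lesssim> (UNIV :: real set)"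
    unfolding lepoll_def by (intro exI[of _ of_bool]) (auto simp: inj_on_def)
  then have "(UNIV :: (real \<times> (real \<times> bool) \<times> real) set) \<lesssim> (UNIV :: real set)"
    by (intro prod lepoll_refl)
  then show ?thesis using lepoll_trans subset_imp_lepoll by blast
qed

theorem theorem6p1:
  shows "\<exists>(Z :: real metric) (f :: real \<Rightarrow> real).
    connected_space (mtopology_of Z) \<and>
    mcomplete_of Z \<and>
    mspace Z \<approx> (UNIV :: real set) \<and>
    has_density (mtopology_of Z) (UNIV :: real set) \<and>
    f ` mspace Z = {0<..<1} \<and>
    continuous_map (mtopology_of Z) (top_of_set {0<..<1}) f \<and>
    monotone_map (mtopology_of Z) (top_of_set {0<..<1}) f \<and>
    hereditarily_quotient_map (mtopology_of Z) (top_of_set {0<..<1}) f \<and>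
    (\<forall>z\<in>mspace Z. local_max_at (mtopology_of Z) f z \<or> local_min_at (mtopology_of Z) f z)"
proof -
  obtain e :: "_ \<Rightarrow> real" where e: "inj_on e graph_coords"
    using graph_coords_lepoll_reals by (auto simp: lepoll_def)
  interpret hub_graph "e ` graph_coords" "inv_into graph_coords e"
    by standard (rule bij_betw_inv_into[OF inj_on_imp_bij_betw[OF e]])
  have top: "mtopology_of Self = mtopology" "mspace Self = e ` graph_coords"
    by (simp_all add: mtopology_of_Self)
  have card: "e ` graph_coords \<approx> (UNIV :: real set)"
  proof (rule lepoll_antisym)
    show "e ` graph_coords \<lesssim> (UNIV :: real set)" by (simp add: subset_imp_lepoll)
    show "(UNIV :: real set) \<lesssim> e ` graph_coords"
      by (rule reals_lepoll_dense) (use closure_of_topspace[of mtopology] in auto)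
  qed
  then have "has_density mtopology (UNIV :: real set)"
    unfolding has_density_def
    using reals_lepoll_dense closure_of_topspace[of mtopology]
    by (auto intro!: exI[of _ "e ` graph_coords"])
  then show ?thesis
    using connected_mtopology mcomplete card lev_image continuous_lev monotone_lev
      hereditarily_quotient_lev local_extremum
    by (intro exI[of _ Self] exI[of _ lev]) (simp add: top mcomplete_of_def)
qed

end
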